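(* Let $A$ be a generalized Cartan matrix with associated data $\mathfrak h_{\mathbb R}^*,\Pi,W,\overline C$, let $\mu\in\overline C$, let $H$ be the convex hull of $W\mu$, and let $I\subseteq\Pi$ be $\mu$-connected. Let $F_I$ be the convex hull of $W_I\mu$. Then $F_I$ is a fundamental face of $H$ with $$\operatorname{ri}(F_I)\cap(\mu-\mathbb R_{>}I)\cap C_{I_*}\ne\emptyset.$$ The affine hull of $F_I$ is $\mu+\mathbb R I$. In particular, $\dim F_I=|I|$.
   Context: Let $A=(a_{ij})_{i,j=1}^m$ be a generalized Cartan matrix (integral, $a_{ii}=2$, $a_{ij}\le 0$ for $i\ne j$, $a_{ij}=0\Rightarrow a_{ji}=0$) of rank $l$. Let $(\mathfrak h_{\mathbb R},\Pi,\Pi^\vee)$ be a realization of $A$ over $\mathbb R$: $\mathfrak h_{\mathbb R}$ is a real vector space of dimension $2m-l$, and $\Pi=\{\alpha_1,\dots,\alpha_m\}\subset\mathfrak h_{\mathbb R}^*$ and $\Pi^\vee=\{\alpha_1^\vee,\dots,\alpha_m^\vee\}\subset\mathfrak h_{\mathbb R}$ are linearly independent with $\langle\alpha_j,\alpha_i^\vee\rangle=a_{ij}$. The Weyl group $W\subset GL(\mathfrak h_{\mathbb R}^* )$ is generated by the reflections $r_{\alpha_i}(\eta)=\eta-\langle\eta,\alpha_i^\vee\rangle\alpha_i$. For $I\subseteq\Pi$, $W_I$ is the subgroup generated by $r_\alpha$, $\alpha\in I$. The fundamental chamber is $\overline C=\{\eta\in\mathfrak h_{\mathbb R}^*\mid\langle\eta,\alpha^\vee\rangle\ge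 0\ \forall\alpha\in\Pi\}$. For $J\subseteq\Pi$, $C_J=\{\eta\mid\langle\eta,\alpha^\vee\rangle=0\ \forall\alpha\in J,\ \langle\eta,\alpha^\vee\rangle>0\ \forall\alpha\in\Pi\setminus J\}$. Set $J_0=\{\alpha\in\Pi\mid\langle\mu,\alpha^\vee\rangle=0\}$. Connected components of a subset of $\Pi$ are taken in the Dynkin diagram of $A$ (distinct $\alpha,\beta\in\Pi$ are adjacent iff $\langle\alpha,\beta^\vee\rangle\ne 0$). A subset $I\subseteq\Pi$ is $\mu$-connected if no connected component of $I$ is contained in $J_0$ (the empty set is $\mu$-connected). For $\mu$-connected $I$, $I_*=\{\alpha\in J_0\setminus I\mid r_\alpha r_\beta=r_\beta r_\alpha\ \forall\beta\in I\}$. $\mathbb R_{>}I=\{\sum_{\alpha\in I}m_\alpha\alpha\mid m_\alpha>0\ \forall\alpha\in I\}$ with $\mathbb R_{>}\emptyset=\{0\}$; $\mathbb R I$ is the real span of $I$. A face of the convex set $H$ is a convex subset $F\subseteq H$ such that every closed line segment in $H$ having a relative interior point in $F$ has both endpoints in $F$ (so $\emptyset$ and $H$ are faces). A face $F$ is fundamental if $F=\emptyset$ or $\operatorname{ri}(F)\cap\overline C\ne\emptyset$, where $\operatorname{ri}$ denotes relative interior. *)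

theory Defs
  imports "HOL-Analysis.Analysis" "HOL-Algebra.Generated_Groups"
begin

text \<open>Simple roots and coroots are families indexed by a finite type \<open>'m\<close>. Subsets of \<open>\<Pi>\<close> are
  represented by the corresponding subsets of \<open>'m\<close>, the simple roots being pairwise distinct.\<close>

definition generalized_cartan_matrix :: "int ^ 'm ^ 'm \<Rightarrow> bool" where
  "generalized_cartan_matrix A \<longleftrightarrow>
     (\<forall>i. A $ i $ i = 2) \<and>
     (\<forall>i j. i \<noteq> j \<longrightarrow> A $ i $ j \<le> 0) \<and>
     (\<forall>i j. A $ i $ j = 0 \<longrightarrow> A $ j $ i = 0)"

text \<open>The dual of \<open>h\<close> is a Euclidean space type \<open>'v\<close> (so that affine dimension is available)
  together with an evaluation map \<open>pair :: 'v \<Rightarrow> 'h \<Rightarrow> real\<close> identifying \<open>'v\<close> with the space of all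
  linear functionals on \<open>'h\<close>. The inner products of \<open>'h\<close> and \<open>'v\<close> play no role; the topology
  of \<open>'v\<close> is its unique Hausdorff vector space topology.\<close>

definition dual_pairing :: "('v::euclidean_space \<Rightarrow> 'h::euclidean_space \<Rightarrow> real) \<Rightarrow> bool" where
  "dual_pairing pair \<longleftrightarrow> bilinear pair \<and> bij_betw pair UNIV {f. linear f}"

text \<open>The equation \<open>dim h = 2 m - l\<close> is written additively to avoid truncated subtraction.\<close>

definition realization ::
  "int ^ 'm ^ 'm \<Rightarrow> ('v::euclidean_space \<Rightarrow> 'h::euclidean_space \<Rightarrow> real)
    \<Rightarrow> ('m \<Rightarrow> 'v) \<Rightarrow> ('m \<Rightarrow> 'h) \<Rightarrow> bool" where
  "realization A pair \<alpha> \<alpha>v \<longleftrightarrow>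
     dual_pairing pair \<and>
     DIM('h) + rank (\<chi> i j. real_of_int (A $ i $ j)) = 2 * CARD('m) \<and>
     inj \<alpha> \<and> independent (range \<alpha>) \<and>
     inj \<alpha>v \<and> independent (range \<alpha>v) \<and>
     (\<forall>i j. pair (\<alpha> j) (\<alpha>v i) = real_of_int (A $ i $ j))"

definition GL :: "('v::real_vector \<Rightarrow> 'v) monoid" where
  "GL = \<lparr>carrier = {g. linear g \<and> bij g}, mult = (\<circ>), one = id\<rparr>"

definition reflection ::
  "('v::real_vector \<Rightarrow> 'h \<Rightarrow> real) \<Rightarrow> ('m \<Rightarrow> 'v) \<Rightarrow> ('m \<Rightarrow> 'h) \<Rightarrow> 'm \<Rightarrow> 'v \<Rightarrow> 'v" where
  "reflection pair \<alpha> \<alpha>v i \<eta> = \<eta> - pair \<eta> (\<alpha>v i) *\<^sub>R \<alpha> i"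

definition weyl_subgroup ::
  "('v::real_vector \<Rightarrow> 'h \<Rightarrow> real) \<Rightarrow> ('m \<Rightarrow> 'v) \<Rightarrow> ('m \<Rightarrow> 'h) \<Rightarrow> 'm set \<Rightarrow> ('v \<Rightarrow> 'v) set" where
  "weyl_subgroup pair \<alpha> \<alpha>v I = generate GL (reflection pair \<alpha> \<alpha>v ` I)"

abbreviation weyl_group ::
  "('v::real_vector \<Rightarrow> 'h \<Rightarrow> real) \<Rightarrow> ('m \<Rightarrow> 'v) \<Rightarrow> ('m \<Rightarrow> 'h) \<Rightarrow> ('v \<Rightarrow> 'v) set" where
  "weyl_group pair \<alpha> \<alpha>v \<equiv> weyl_subgroup pair \<alpha> \<alpha>v UNIV"

definition orbit_hull :: "('v::real_vector \<Rightarrow> 'v) set \<Rightarrow> 'v \<Rightarrow> 'v set" where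
  "orbit_hull G \<mu> = convex hull ((\<lambda>w. w \<mu>) ` G)"

definition fundamental_chamber :: "('v \<Rightarrow> 'h \<Rightarrow> real) \<Rightarrow> ('m \<Rightarrow> 'h) \<Rightarrow> 'v set" where
  "fundamental_chamber pair \<alpha>v = {\<eta>. \<forall>i. pair \<eta> (\<alpha>v i) \<ge> 0}"

definition chamber_facet :: "('v \<Rightarrow> 'h \<Rightarrow> real) \<Rightarrow> ('m \<Rightarrow> 'h) \<Rightarrow> 'm set \<Rightarrow> 'v set" where
  "chamber_facet pair \<alpha>v J =
     {\<eta>. (\<forall>i\<in>J. pair \<eta> (\<alpha>v i) = 0) \<and> (\<forall>i\<in>- J. pair \<eta> (\<alpha>v i) > 0)}"

text \<open>The set written \<open>J\<^sub>0\<close>.\<close>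

definition orthogonal_roots :: "('v \<Rightarrow> 'h \<Rightarrow> real) \<Rightarrow> ('m \<Rightarrow> 'h) \<Rightarrow> 'v \<Rightarrow> 'm set" where
  "orthogonal_roots pair \<alpha>v \<mu> = {i. pair \<mu> (\<alpha>v i) = 0}"

definition dynkin_edges :: "('v \<Rightarrow> 'h \<Rightarrow> real) \<Rightarrow> ('m \<Rightarrow> 'v) \<Rightarrow> ('m \<Rightarrow> 'h) \<Rightarrow> ('m \<times> 'm) set" where
  "dynkin_edges pair \<alpha> \<alpha>v = {(i, j). i \<noteq> j \<and> pair (\<alpha> i) (\<alpha>v j) \<noteq> 0}"

text \<open>For a realization of a generalized Cartan matrix the edge relation is symmetric, so the
  relation below restricts to an equivalence relation on \<open>I\<close>.\<close>

definition dynkin_components ::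
  "('v \<Rightarrow> 'h \<Rightarrow> real) \<Rightarrow> ('m \<Rightarrow> 'v) \<Rightarrow> ('m \<Rightarrow> 'h) \<Rightarrow> 'm set \<Rightarrow> 'm set set" where
  "dynkin_components pair \<alpha> \<alpha>v I = I // (dynkin_edges pair \<alpha> \<alpha>v \<inter> I \<times> I)\<^sup>*"

definition mu_connected ::
  "('v \<Rightarrow> 'h \<Rightarrow> real) \<Rightarrow> ('m \<Rightarrow> 'v) \<Rightarrow> ('m \<Rightarrow> 'h) \<Rightarrow> 'v \<Rightarrow> 'm set \<Rightarrow> bool" where
  "mu_connected pair \<alpha> \<alpha>v \<mu> I \<longleftrightarrow>
     (\<forall>K \<in> dynkin_components pair \<alpha> \<alpha>v I. \<not> K \<subseteq> orthogonal_roots pair \<alpha>v \<mu>)"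

text \<open>The set written \<open>I\<^sub>*\<close>.\<close>

definition lower_star ::
  "('v::real_vector \<Rightarrow> 'h \<Rightarrow> real) \<Rightarrow> ('m \<Rightarrow> 'v) \<Rightarrow> ('m \<Rightarrow> 'h) \<Rightarrow> 'v \<Rightarrow> 'm set \<Rightarrow> 'm set" where
  "lower_star pair \<alpha> \<alpha>v \<mu> I =
     {i \<in> orthogonal_roots pair \<alpha>v \<mu> - I.
        \<forall>j\<in>I. reflection pair \<alpha> \<alpha>v i \<circ> reflection pair \<alpha> \<alpha>v j
            = reflection pair \<alpha> \<alpha>v j \<circ> reflection pair \<alpha> \<alpha>v i}"

definition pos_combinations :: "('m \<Rightarrow> 'v::real_vector) \<Rightarrow> 'm set \<Rightarrow> 'v set" where
  "pos_combinations \<alpha> I = {(\<Sum>i\<in>I. c i *\<^sub>R \<alpha> i) |c. \<forall>i\<in>I. c i > (0::real)}"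

definition fundamental_face ::
  "('v::euclidean_space \<Rightarrow> 'h \<Rightarrow> real) \<Rightarrow> ('m \<Rightarrow> 'h) \<Rightarrow> 'v set \<Rightarrow> 'v set \<Rightarrow> bool" where
  "fundamental_face pair \<alpha>v F H \<longleftrightarrow>
     F face_of H \<and> (F = {} \<or> rel_interior F \<inter> fundamental_chamber pair \<alpha>v \<noteq> {})"

end

theory Submission
  imports Defs
begin

text \<open>By Tits' lemma an element \<open>w\<close> of the Weyl group with \<open>l (w s\<^sub>i) \<ge> l w\<close> maps \<open>\<alpha> i\<close> into the cone
  spanned by the simple roots; the proof reduces to rank two, where either the coordinates can be
  controlled for all alternating words or the dihedral group has order 4, 6, 8 or 12. Hence
  \<open>\<mu> - w \<mu>\<close> lies in the cone of all simple roots, and \<open>w \<mu> \<in> W\<^sub>I \<mu>\<close> as soon as \<open>\<mu> - w \<mu>\<close> lies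
  in the cone of \<open>I\<close>. So a linear functional vanishing on \<open>I\<close> and equal to 1 on the other simple
  roots cuts out \<open>F\<^sub>I\<close> as an exposed face of \<open>H\<close>. The direction space of \<open>F\<^sub>I\<close> is stable
  under \<open>W\<^sub>I\<close>, so it contains a whole component of \<open>I\<close> together with any one of its roots not
  orthogonal to \<open>\<mu>\<close>. Finally, moving \<open>\<mu>\<close> repeatedly towards its reflections inside \<open>F\<^sub>I\<close> spreads strict
  positivity along the Dynkin diagram, and a small shift towards a point of the relative
  interior preserves all the strict inequalities obtained.\<close>

section \<open>Simple reflections and words in them\<close>

text \<open>\<open>f i\<close> plays the role of the pairing with the \<open>i\<close>-th simple coroot.\<close>

locale root_datum =
  fixes \<alpha> :: "'m::finite \<Rightarrow> 'v::euclidean_space"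
    and f :: "'m \<Rightarrow> 'v \<Rightarrow> real"
    and A :: "'m \<Rightarrow> 'm \<Rightarrow> int"
  assumes linear_f: "linear (f i)"
    and f_root: "f i (\<alpha> j) = of_int (A i j)"
    and A_diag: "A i i = 2"
    and A_off: "i \<noteq> j \<Longrightarrow> A i j \<le> 0"
    and A_zero: "A i j = 0 \<Longrightarrow> A j i = 0"
    and inj_root: "inj \<alpha>"
    and independent_root: "independent (range \<alpha>)"
begin

lemmas f_simps = linear_add[OF linear_f] linear_diff[OF linear_f] linear_scale[OF linear_f]
  linear_neg[OF linear_f] linear_0[OF linear_f] linear_sum[OF linear_f] f_root

definition s :: "'m \<Rightarrow> 'v \<Rightarrow> 'v" where
  "s i \<eta> = \<eta> - f i \<eta> *\<^sub>R \<alpha> i"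

lemma linear_s: "linear (s i)"
  by (rule linearI) (simp_all add: s_def f_simps algebra_simps)

lemma s_s [simp]: "s i (s i x) = x"
  by (simp add: s_def f_simps A_diag algebra_simps)

lemma s_root [simp]: "s i (\<alpha> i) = - \<alpha> i"
  by (simp add: s_def f_simps A_diag algebra_simps scaleR_2)

definition act :: "'m list \<Rightarrow> 'v \<Rightarrow> 'v" where
  "act xs = foldr s xs"

lemma act_simps [simp]: "act [] = (\<lambda>x. x)" "act (i # xs) x = s i (act xs x)"
  "act (xs @ ys) x = act xs (act ys x)"
  by (auto simp: act_def)

lemma linear_act: "linear (act xs)"
proof (induction xs)
  case (Cons i xs)
  have "act (i # xs) = s i \<circ> act xs" by auto
  then show ?case using linear_compose[OF Cons linear_s] by metis
qed (simp add: linear_id[unfolded id_def])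

lemma act_rev [simp]: "act xs (act (rev xs) x) = x" "act (rev xs) (act xs x) = x"
proof -
  have *: "act (rev xs) (act xs x) = x" for xs x
    by (induction xs arbitrary: x) auto
  show "act xs (act (rev xs) x) = x" "act (rev xs) (act xs x) = x"
    using *[of "rev xs"] * by auto
qed

lemma span_diff_act: "set xs \<subseteq> J \<Longrightarrow> act xs x - x \<in> span (\<alpha> ` J)"
proof (induction xs)
  case (Cons i xs)
  have "act (i # xs) x - x = (act xs x - x) - f i (act xs x) *\<^sub>R \<alpha> i"
    by (simp add: s_def)
  moreover have "\<alpha> i \<in> span (\<alpha> ` J)" "act xs x - x \<in> span (\<alpha> ` J)"
    using Cons by (auto intro: span_base)
  ultimately show ?case by (metis span_diff span_scale)
qed (simp add: span_zero)

subsection \<open>Coordinates\<close>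

text \<open>Off the span of the roots this is an arbitrary linear extension, so its sign is
  informative only for vectors known to lie in the span.\<close>

definition coord :: "'m \<Rightarrow> 'v \<Rightarrow> real" where
  "coord i = (SOME c. linear c \<and> (\<forall>j. c (\<alpha> j) = (if j = i then 1 else 0)))"

lemma coord: "linear (coord i)" "coord i (\<alpha> j) = (if j = i then 1 else 0)"
proof -
  obtain c :: "'v \<Rightarrow> real" where "linear c" "\<forall>x\<in>range \<alpha>. c x = (if x = \<alpha> i then 1 else 0)"
    using linear_independent_extend[OF independent_root, of "\<lambda>x. if x = \<alpha> i then 1 else 0"]
    by auto
  then have "\<exists>c::'v \<Rightarrow> real. linear c \<and> (\<forall>j. c (\<alpha> j) = (if j = i then 1 else 0))"
    using inj_root by (intro exI[of _ c]) (auto simp: inj_eq)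
  from someI_ex[OF this] show "linear (coord i)" "coord i (\<alpha> j) = (if j = i then 1 else 0)"
    unfolding coord_def by auto
qed

lemmas coord_simps = linear_add[OF coord(1)] linear_diff[OF coord(1)] linear_scale[OF coord(1)]
  linear_neg[OF coord(1)] linear_0[OF coord(1)] linear_sum[OF coord(1)] coord(2)

definition pos_cone :: "'m set \<Rightarrow> 'v set" where
  "pos_cone J = {\<Sum>i\<in>J. c i *\<^sub>R \<alpha> i |c. \<forall>i\<in>J. 0 \<le> c i}"

lemma coord_comb: "coord i (\<Sum>j\<in>J. c j *\<^sub>R \<alpha> j) = (if i \<in> J then c i else 0)"
  by (simp add: coord_simps if_distrib[where f="\<lambda>x. _ * x"] cong: if_cong)

lemma span_eq_coord:
  assumes "x \<in> span (\<alpha> ` J)"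
  shows "x = (\<Sum>i\<in>J. coord i x *\<^sub>R \<alpha> i)"
proof -
  obtain u where "x = (\<Sum>v\<in>\<alpha> ` J. u v *\<^sub>R v)"
    using assms by (subst (asm) span_finite) auto
  then have x: "x = (\<Sum>i\<in>J. u (\<alpha> i) *\<^sub>R \<alpha> i)"
    using inj_root by (simp add: sum.reindex inj_on_subset)
  have "coord i x = u (\<alpha> i)" if "i \<in> J" for i
    using that by (simp add: x coord_comb)
  then have "(\<Sum>i\<in>J. coord i x *\<^sub>R \<alpha> i) = (\<Sum>i\<in>J. u (\<alpha> i) *\<^sub>R \<alpha> i)"
    by (intro sum.cong) auto
  then show ?thesis using x by metis
qed

lemma coord_outside: "x \<in> span (\<alpha> ` J) \<Longrightarrow> i \<notin> J \<Longrightarrow> coord i x = 0"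
proof -
  assume "x \<in> span (\<alpha> ` J)" "i \<notin> J"
  then have "coord i x = coord i (\<Sum>j\<in>J. coord j x *\<^sub>R \<alpha> j)"
    by (intro arg_cong[of _ _ "coord i"] span_eq_coord)
  then show "coord i x = 0" using \<open>i \<notin> J\<close> unfolding coord_comb by simp
qed

text \<open>Independence of the roots splits membership into a support condition and a sign
  condition that no longer mentions \<open>J\<close>; later arguments establish the two
  separately.\<close>

lemma mem_pos_cone: "x \<in> pos_cone J \<longleftrightarrow> x \<in> span (\<alpha> ` J) \<and> (\<forall>i. 0 \<le> coord i x)"
proof safe
  assume "x \<in> pos_cone J"
  then obtain c where x: "x = (\<Sum>i\<in>J. c i *\<^sub>R \<alpha> i)" "\<forall>i\<in>J. 0 \<le> c i"
    by (auto simp: pos_cone_def)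
  show "x \<in> span (\<alpha> ` J)"
    unfolding x by (intro span_sum span_scale span_base) auto
  show "0 \<le> coord i x" for i using x by (simp add: coord_comb)
next
  assume "x \<in> span (\<alpha> ` J)" "\<forall>i. 0 \<le> coord i x"
  then show "x \<in> pos_cone J"
    unfolding pos_cone_def by (intro CollectI exI[of _ "\<lambda>i. coord i x"] conjI span_eq_coord) auto
qed

lemma pos_cone_zero: "0 \<in> pos_cone J"
  by (auto simp: mem_pos_cone coord_simps span_zero)

lemma pos_cone_add: "x \<in> pos_cone J \<Longrightarrow> y \<in> pos_cone J \<Longrightarrow> x + y \<in> pos_cone J"
  by (auto simp: mem_pos_cone coord_simps span_add)

lemma pos_cone_scale: "x \<in> pos_cone J \<Longrightarrow> 0 \<le> c \<Longrightarrow> c *\<^sub>R x \<in> pos_cone J"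
  by (auto simp: mem_pos_cone coord_simps span_scale)

lemma pos_cone_sum: "(\<And>i. i \<in> S \<Longrightarrow> g i \<in> pos_cone J) \<Longrightarrow> sum g S \<in> pos_cone J"
  by (induction S rule: infinite_finite_induct) (auto simp: pos_cone_zero pos_cone_add)

lemma root_in_pos_cone: "i \<in> J \<Longrightarrow> \<alpha> i \<in> pos_cone J"
  by (auto simp: mem_pos_cone coord_simps intro: span_base)

lemma pos_cone_antisym:
  assumes "x \<in> pos_cone J" "- x \<in> pos_cone J"
  shows "x = 0"
proof -
  have "coord i x = 0" for i
    using assms by (simp add: mem_pos_cone coord_simps order_antisym)
  then have "(\<Sum>i\<in>J. coord i x *\<^sub>R \<alpha> i) = 0" by simp
  then show ?thesis using assms span_eq_coord[of x J] by (metis mem_pos_cone)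
qed

subsection \<open>Dihedral subgroups\<close>

text \<open>The alternating word of length \<open>k\<close> in \<open>i\<close> and \<open>j\<close> whose last letter is \<open>j\<close>.\<close>

primrec alt :: "'m \<Rightarrow> 'm \<Rightarrow> nat \<Rightarrow> 'm list" where
  "alt i j 0 = []"
| "alt i j (Suc k) = (if even k then j else i) # alt i j k"

lemma set_alt: "set (alt i j k) \<subseteq> {i, j}"
  by (induction k) auto

lemma length_alt [simp]: "length (alt i j k) = k"
  by (induction k) auto

lemma alt_split: "m \<le> k \<Longrightarrow> \<exists>pre. set pre \<subseteq> {i, j} \<and> alt i j k = pre @ alt i j m"
proof (induction k rule: dec_induct)
  case base
  show ?case by (intro exI[of _ "[]"]) auto
next
  case (step k)
  then obtain pre where "set pre \<subseteq> {i, j}" "alt i j k = pre @ alt i j m" by auto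
  then show ?case by (intro exI[of _ "(if even k then j else i) # pre"]) auto
qed

lemma alt_last: "0 < m \<Longrightarrow> \<exists>q. set q \<subseteq> {i, j} \<and> alt i j m = q @ [j]"
  using alt_split[of 1 m i j] by auto

text \<open>Appending \<open>i\<close> costs one letter. A repeated adjacent letter in
  \<open>u\<close> cancels and saves two, and a final \<open>i\<close> cancels with the appended
  one; a nonempty word avoiding both alternates and ends in \<open>j\<close>.\<close>

lemma alt_or_shorter:
  assumes "set u \<subseteq> {i, j}"
  shows "(\<exists>k. u = alt i j k) \<or>
    (\<exists>u'. set u' \<subseteq> {i, j} \<and> length u' < length u \<and> act u' = act (u @ [i]))"
  using assms
proof (induction u)
  case Nil
  show ?case by (intro disjI1 exI[of _ 0]) simp
next
  case (Cons x u)
  then consider k where "u = alt i j k"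
    | u' where "set u' \<subseteq> {i, j}" "length u' < length u" "act u' = act (u @ [i])" by (auto simp del: act_simps)
  then show ?case
  proof cases
    case 1
    show ?thesis
    proof (cases "x = (if even k then j else i)")
      case True
      then show ?thesis using 1 by (intro disjI1 exI[of _ "Suc k"]) simp
    next
      case False
      show ?thesis
      proof (cases k)
        case 0
        then have "x = i" using False Cons.prems by (auto split: if_splits)
        then show ?thesis using 0 1 by (intro disjI2 exI[of _ "[]"]) auto
      next
        case (Suc k')
        then have "x # u = x # x # alt i j k'"
          using False Cons.prems 1 by (auto split: if_splits)
        then show ?thesis using set_alt[of i j k'] Cons.prems
          by (intro disjI2 exI[of _ "alt i j k' @ [i]"]) auto
      qed
    qed
  next
    case 2
    then show ?thesis using Cons.prems
      by (intro disjI2 exI[of _ "x # u'"]) auto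
  qed
qed

text \<open>The last conjunct is an invariant that makes the next coordinate nonnegative.\<close>

lemma alt_root_infinite:
  assumes "i \<noteq> j" and "4 \<le> A i j * A j i"
  shows "\<exists>x y. 0 \<le> x \<and> 0 \<le> y \<and> act (alt i j k) (\<alpha> i) = x *\<^sub>R \<alpha> i + y *\<^sub>R \<alpha> j \<and>
    (if even k then 2 * y \<le> - of_int (A j i) * x else 2 * x \<le> - of_int (A i j) * y)"
proof (induction k)
  case 0
  show ?case using A_off[of j i] assms by (intro exI[of _ 1] exI[of _ 0]) auto
next
  case (Suc k)
  define a b :: real where "a = - of_int (A i j)" and "b = - of_int (A j i)"
  have ab: "0 \<le> a" "0 \<le> b" using A_off assms by (auto simp: a_def b_def)
  have "4 \<le> (of_int (A i j * A j i) :: real)" using assms(2) by linarith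
  then have ab4: "4 \<le> a * b" by (simp add: a_def b_def)
  have fij: "f i (\<alpha> j) = - a" "f j (\<alpha> i) = - b" "f i (\<alpha> i) = 2" "f j (\<alpha> j) = 2"
    by (auto simp: f_root A_diag a_def b_def)
  obtain x y where xy: "0 \<le> x" "0 \<le> y" "act (alt i j k) (\<alpha> i) = x *\<^sub>R \<alpha> i + y *\<^sub>R \<alpha> j"
    "if even k then 2 * y \<le> b * x else 2 * x \<le> a * y"
    using Suc unfolding a_def b_def by blast
  \<comment> \<open>One estimate serves both parities: a reflection replaces the coefficient
    \<open>r\<close> by \<open>q' * p - r\<close>, which by the invariant is at least half of
    \<open>q' * p\<close>; then \<open>4 \<le> q * q'\<close> restores the invariant with the roles
    exchanged.\<close>
  have step: "2 * p \<le> q * (q' * p - r)" "0 \<le> q' * p - r"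
    if "0 \<le> p" "0 \<le> q" "0 \<le> r" "0 \<le> q'" "2 * r \<le> q' * p" "4 \<le> q * q'" for p q r q' :: real
  proof -
    have "q * (2 * r) \<le> q * (q' * p)" using that by (intro mult_left_mono) auto
    moreover have "4 * p \<le> (q * q') * p" using that by (intro mult_right_mono) auto
    ultimately show "2 * p \<le> q * (q' * p - r)" by (simp add: algebra_simps)
    show "0 \<le> q' * p - r" using that by linarith
  qed
  show ?case
  proof (cases "even k")
    case True
    have "act (alt i j (Suc k)) (\<alpha> i) = x *\<^sub>R \<alpha> i + (b * x - y) *\<^sub>R \<alpha> j"
      using True by (simp add: xy s_def f_simps(1-6) fij algebra_simps flip: scaleR_2)
    then show ?thesis using True step[of x a y b] xy ab ab4
      by (intro exI[of _ x] exI[of _ "b * x - y"]) (auto simp: a_def[symmetric])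
  next
    case False
    have "act (alt i j (Suc k)) (\<alpha> i) = (a * y - x) *\<^sub>R \<alpha> i + y *\<^sub>R \<alpha> j"
      using False by (simp add: xy s_def f_simps(1-6) fij algebra_simps flip: scaleR_2)
    then show ?thesis using False step[of y b x a] xy ab ab4
      by (intro exI[of _ "a * y - x"] exI[of _ y]) (auto simp: b_def[symmetric] mult.commute)
  qed
qed

text \<open>The bound leaves the types A1 x A1, A2, B2 and G2, where \<open>m\<close> is 2, 3, 4 or
  6 and everything is verified by computation.\<close>

lemma dihedral_finite:
  assumes "i \<noteq> j" and "A i j * A j i < 4"
  shows "\<exists>m>0. act (alt i j m) = act (alt j i m) \<and>
    (\<forall>k<m. \<exists>x y. 0 \<le> x \<and> 0 \<le> y \<and> act (alt i j k) (\<alpha> i) = x *\<^sub>R \<alpha> i + y *\<^sub>R \<alpha> j)"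
proof -
  have neg: "A i j \<le> 0" "A j i \<le> 0" and zero: "A i j = 0 \<longleftrightarrow> A j i = 0"
    using A_off assms A_zero by auto
  have cases: "(A i j, A j i) \<in> {(0,0), (-1,-1), (-1,-2), (-2,-1), (-1,-3), (-3,-1)}"
  proof (cases "A i j = 0")
    case False
    define a b where "a = - A i j" and "b = - A j i"
    have "1 \<le> a" "1 \<le> b" "a * b < 4" using neg zero False assms by (auto simp: a_def b_def)
    moreover from this have "a * 1 \<le> a * b" "1 * b \<le> a * b"
      by (intro mult_mono; simp)+
    ultimately have "a * b < 4" "a = 1 \<or> a = 2 \<or> a = 3" "b = 1 \<or> b = 2 \<or> b = 3" by linarith+
    then have "(a, b) \<in> {(1,1), (1,2), (2,1), (1,3), (3,1)}" by (elim disjE) simp_all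
    then show ?thesis unfolding a_def b_def by (elim insertE) (simp_all add: minus_equation_iff)
  qed (use zero in auto)
  define a b :: real where "a = - of_int (A i j)" and "b = - of_int (A j i)"
  have fij: "f i (\<alpha> j) = - a" "f j (\<alpha> i) = - b" "f i (\<alpha> i) = 2" "f j (\<alpha> j) = 2"
    by (auto simp: f_root A_diag a_def b_def)
  \<comment> \<open>The free vector \<open>\<eta>\<close> makes the braid computation valid on the
    whole space, not only on the plane of the two roots; with \<open>\<eta> = 0\<close> the same
    rules compute images of \<open>\<alpha> i\<close>.\<close>
  have s_comb: "s i (\<eta> + x *\<^sub>R \<alpha> i + y *\<^sub>R \<alpha> j) = \<eta> + (a * y - x - f i \<eta>) *\<^sub>R \<alpha> i + y *\<^sub>R \<alpha> j"
    "s j (\<eta> + x *\<^sub>R \<alpha> i + y *\<^sub>R \<alpha> j) = \<eta> + x *\<^sub>R \<alpha> i + (b * x - y - f j \<eta>) *\<^sub>R \<alpha> j"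
    for \<eta> x y by (simp_all add: s_def f_simps(1-6) fij algebra_simps flip: scaleR_2)
  have braid: "act (alt i j m) = act (alt j i m)"
    if "\<And>\<eta>. act (alt i j m) (\<eta> + 0 *\<^sub>R \<alpha> i + 0 *\<^sub>R \<alpha> j) = act (alt j i m) (\<eta> + 0 *\<^sub>R \<alpha> i + 0 *\<^sub>R \<alpha> j)" for m
    using that by auto
  let ?P = "\<lambda>k. \<exists>x y. 0 \<le> x \<and> 0 \<le> y \<and> act (alt i j k) (\<alpha> i) = x *\<^sub>R \<alpha> i + y *\<^sub>R \<alpha> j"
  \<comment> \<open>The numbers passed to \<open>pos\<close> below are \<open>k\<close> and the two
    coordinates of the image of \<open>\<alpha> i\<close> under the alternating word of length
    \<open>k\<close>.\<close>
  have pos: "?P k" if "act (alt i j k) (0 + 1 *\<^sub>R \<alpha> i + 0 *\<^sub>R \<alpha> j) = 0 + x *\<^sub>R \<alpha> i + y *\<^sub>R \<alpha> j"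
    "0 \<le> x" "0 \<le> y" for k x y
    using that by (intro exI[of _ x] exI[of _ y]) simp
  have f_zero: "f k 0 = 0" for k by (rule f_simps(5))
  have alt_2: "alt i' j' 2 = [i', j']" for i' j'
    unfolding numeral_2_eq_2 by simp
  have alt_eval: "alt i' j' 0 = []" "alt i' j' 1 = [j']" "alt i' j' 2 = [i', j']"
    "alt i' j' 3 = [j', i', j']" "alt i' j' 4 = [i', j', i', j']"
    "alt i' j' 5 = [j', i', j', i', j']" "alt i' j' 6 = [i', j', i', j', i', j']" for i' j'
    using alt.simps(2)[of i' j' 0] alt.simps(2)[of i' j' 1] alt.simps(2)[of i' j' 2]
      alt.simps(2)[of i' j' 3] alt.simps(2)[of i' j' 4] alt.simps(2)[of i' j' 5] alt_2[of i' j'] by simp_all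
  note compute = s_comb alt_eval act_simps(1,2)
  consider "a = 0" "b = 0" | "a = 1" "b = 1" | "a = 1" "b = 2" | "a = 2" "b = 1"
    | "a = 1" "b = 3" | "a = 3" "b = 1"
    using cases by (auto simp: a_def b_def)
  then show ?thesis
  proof cases
    case 1
    have "act (alt i j 2) = act (alt j i 2)"
      by (rule braid) (simp only: compute 1, simp add: algebra_simps)
    moreover have "?P 0" "?P 1"
      using pos[of 0 1 0] pos[of 1 1 0] unfolding compute 1 f_zero by simp_all
    ultimately show ?thesis by (intro exI[of _ 2]) (simp add: eval_nat_numeral All_less_Suc)
  next
    case 2
    have "act (alt i j 3) = act (alt j i 3)"
      by (rule braid) (simp only: compute 2, simp add: algebra_simps)
    moreover have "?P 0" "?P 1" "?P 2"
      using pos[of 0 1 0] pos[of 1 1 1] pos[of 2 0 1] unfolding compute 2 f_zero by simp_all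
    ultimately show ?thesis by (intro exI[of _ 3]) (simp add: eval_nat_numeral All_less_Suc)
  next
    case 3
    have "act (alt i j 4) = act (alt j i 4)"
      by (rule braid) (simp only: compute 3, simp add: algebra_simps)
    moreover have "?P 0" "?P 1" "?P 2" "?P 3"
      using pos[of 0 1 0] pos[of 1 1 2] pos[of 2 1 2] pos[of 3 1 0] unfolding compute 3 f_zero by simp_all
    ultimately show ?thesis by (intro exI[of _ 4]) (simp add: eval_nat_numeral All_less_Suc)
  next
    case 4
    have "act (alt i j 4) = act (alt j i 4)"
      by (rule braid) (simp only: compute 4, simp add: algebra_simps)
    moreover have "?P 0" "?P 1" "?P 2" "?P 3"
      using pos[of 0 1 0] pos[of 1 1 1] pos[of 2 1 1] pos[of 3 1 0] unfolding compute 4 f_zero by simp_all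
    ultimately show ?thesis by (intro exI[of _ 4]) (simp add: eval_nat_numeral All_less_Suc)
  next
    case 5
    have "act (alt i j 6) = act (alt j i 6)"
      by (rule braid) (simp only: compute 5, simp add: algebra_simps)
    moreover have "?P 0" "?P 1" "?P 2" "?P 3" "?P 4" "?P 5"
      using pos[of 0 1 0] pos[of 1 1 3] pos[of 2 2 3] pos[of 3 2 3] pos[of 4 1 3] pos[of 5 1 0] unfolding compute 5 f_zero by simp_all
    ultimately show ?thesis by (intro exI[of _ 6]) (simp add: eval_nat_numeral All_less_Suc)
  next
    case 6
    have "act (alt i j 6) = act (alt j i 6)"
      by (rule braid) (simp only: compute 6, simp add: algebra_simps)
    moreover have "?P 0" "?P 1" "?P 2" "?P 3" "?P 4" "?P 5"
      using pos[of 0 1 0] pos[of 1 1 1] pos[of 2 2 1] pos[of 3 2 1] pos[of 4 1 1] pos[of 5 1 0] unfolding compute 6 f_zero by simp_all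
    ultimately show ?thesis by (intro exI[of _ 6]) (simp add: eval_nat_numeral All_less_Suc)
  qed
qed


text \<open>Only alternating words need attention. If the word is at least as long as a braid
  relation, its tail can be rewritten to end in \<open>i\<close>, which cancels with the appended
  \<open>i\<close>.\<close>

lemma dihedral_root:
  assumes "i \<noteq> j" and "set u \<subseteq> {i, j}"
  shows "(\<exists>x y. 0 \<le> x \<and> 0 \<le> y \<and> act u (\<alpha> i) = x *\<^sub>R \<alpha> i + y *\<^sub>R \<alpha> j) \<or>
    (\<exists>u'. set u' \<subseteq> {i, j} \<and> length u' < length u \<and> act u' = act (u @ [i]))"
  using alt_or_shorter[OF assms(2)]
proof (elim disjE exE)
  fix k assume u: "u = alt i j k"
  show ?thesis
  proof (cases "A i j * A j i < 4")
    case False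
    then show ?thesis using alt_root_infinite[of i j k] assms(1) u by (metis not_less)
  next
    case True
    then obtain m where m: "0 < m" "act (alt i j m) = act (alt j i m)"
      "\<forall>k<m. \<exists>x y. 0 \<le> x \<and> 0 \<le> y \<and> act (alt i j k) (\<alpha> i) = x *\<^sub>R \<alpha> i + y *\<^sub>R \<alpha> j"
      using dihedral_finite[OF assms(1)] by blast
    show ?thesis
    proof (cases "k < m")
      case True
      then show ?thesis using m(3) u by blast
    next
      case False
      then obtain pre where pre: "set pre \<subseteq> {i, j}" "alt i j k = pre @ alt i j m"
        using alt_split[of m k i j] by auto
      obtain q where q: "set q \<subseteq> {i, j}" "alt j i m = q @ [i]"
        using alt_last[OF m(1), of j i] by auto
      have "length (alt i j k) = length pre + m" "length (alt j i m) = length q + 1"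
        unfolding pre(2) q(2) by simp_all
      then have len: "k = length pre + m" "m = length q + 1" by simp_all
      have "act (u @ [i]) = act (pre @ q)"
        by (rule ext) (simp add: u pre m(2) q)
      then show ?thesis using pre(1) q(1) len u
        by (intro disjI2 exI[of _ "pre @ q"]) auto
    qed
  qed
qed auto

subsection \<open>Length and Tits' lemma\<close>

text \<open>The Coxeter length of the group element \<open>act xs\<close>; elements are handled
  through words representing them.\<close>

definition wlen :: "'m list \<Rightarrow> nat" where
  "wlen xs = (LEAST n. \<exists>ys. length ys = n \<and> act ys = act xs)"

lemma wlen_le: "act ys = act xs \<Longrightarrow> wlen xs \<le> length ys"
  unfolding wlen_def by (rule Least_le) auto

lemma reduced_word: "\<exists>ys. length ys = wlen xs \<and> act ys = act xs"
  unfolding wlen_def by (rule LeastI_ex) auto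

lemma wlen_cong: "act xs = act ys \<Longrightarrow> wlen xs = wlen ys"
  by (simp add: wlen_def)

lemma wlen_append_le: "wlen (xs @ ys) \<le> wlen xs + length ys"
proof -
  obtain zs where "length zs = wlen xs" "act zs = act xs" using reduced_word by blast
  then show ?thesis using wlen_le[of "zs @ ys" "xs @ ys"] by (auto simp: fun_eq_iff)
qed

text \<open>Peels the last letter off a shortest word, leaving an element that \<open>j\<close>
  lengthens, as the inductions on length require.\<close>

lemma reduced_cases:
  obtains "act xs = (\<lambda>x. x)"
  | zs j where "act xs = act (zs @ [j])" "length zs < wlen xs" "wlen xs \<le> wlen zs + 1"
      "wlen zs < wlen xs"
proof -
  obtain ys where ys: "length ys = wlen xs" "act ys = act xs" using reduced_word by blast
  show thesis
  proof (cases ys rule: rev_cases)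
    case Nil
    then show ?thesis using ys that(1) by auto
  next
    case (snoc zs j)
    then have "act xs = act (zs @ [j])" "length zs < wlen xs" using ys by auto
    moreover have "wlen xs \<le> wlen zs + 1"
      using wlen_append_le[of zs "[j]"] wlen_cong[of xs "zs @ [j]"] snoc ys by simp
    moreover have "wlen zs < wlen xs" using wlen_le[of zs zs] snoc ys by simp
    ultimately show ?thesis using that(2) by blast
  qed
qed

text \<open>Tits' lemma. Factor the element as \<open>v\<close> times a word \<open>u\<close> in
  \<open>i\<close> and the last letter \<open>j\<close> of a reduced word, without increasing the
  total length. By induction a minimal \<open>v\<close> keeps both roots positive, so only the rank
  two image under \<open>u\<close> matters.\<close>

lemma act_root_nonneg:
  "wlen xs \<le> wlen (xs @ [i]) \<Longrightarrow> act xs (\<alpha> i) \<in> pos_cone UNIV"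
proof (induction "wlen xs" arbitrary: xs i rule: less_induct)
  case less
  show ?case
  proof (cases xs rule: reduced_cases)
    case 1
    then show ?thesis by (simp add: root_in_pos_cone)
  next
    case (2 zs j)
    have "j \<noteq> i"
    proof
      assume "j = i"
      then have "act zs = act (xs @ [i])" using 2 by (auto simp: fun_eq_iff)
      then show False using wlen_le[of zs "xs @ [i]"] 2 less.prems by simp
    qed
    \<comment> \<open>\<open>v\<close> will be the minimal representative of the coset of \<open>act xs\<close> modulo the dihedral subgroup.\<close>
    define P where "P v = (\<exists>u. set u \<subseteq> {i, j} \<and> act (v @ u) = act xs \<and> wlen v + length u \<le> wlen xs)" for v
    have "P zs" using 2 unfolding P_def by (intro exI[of _ "[j]"]) auto
    then obtain v where v: "P v" and min: "\<And>v'. P v' \<Longrightarrow> wlen v \<le> wlen v'"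
      using ex_has_least_nat[of P zs wlen] by blast
    then obtain u where u: "set u \<subseteq> {i, j}" "act (v @ u) = act xs" "wlen v + length u \<le> wlen xs"
      unfolding P_def by blast
    have vlt: "wlen v < wlen xs" using min[OF \<open>P zs\<close>] 2 by simp
    \<comment> \<open>If \<open>k\<close> shortened \<open>v\<close>, moving it into
      \<open>u\<close> would respect the length bound in \<open>P\<close> and contradict
      minimality.\<close>
    have ext: "act v (\<alpha> k) \<in> pos_cone UNIV" if "k \<in> {i, j}" for k
    proof (rule less.hyps[OF vlt], rule ccontr)
      assume *: "\<not> wlen v \<le> wlen (v @ [k])"
      have "act ((v @ [k]) @ k # u) = act (v @ u)" by (auto simp: fun_eq_iff)
      then have "P (v @ [k])"
        unfolding P_def using u that * by (intro exI[of _ "k # u"]) auto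
      then show False using min * by blast
    qed
    have xs: "act xs x = act v (act u x)" for x
      using u(2) by (metis act_simps(3))
    from dihedral_root[OF \<open>j \<noteq> i\<close>[symmetric] u(1)] show ?thesis
    proof (elim disjE exE conjE)
      fix x y :: real assume "0 \<le> x" "0 \<le> y" "act u (\<alpha> i) = x *\<^sub>R \<alpha> i + y *\<^sub>R \<alpha> j"
      then show ?thesis using ext
        by (simp add: xs linear_add[OF linear_act] linear_scale[OF linear_act] pos_cone_add pos_cone_scale)
    next
      fix u' assume u': "set u' \<subseteq> {i, j}" "length u' < length u" "act u' = act (u @ [i])"
      \<comment> \<open>A shorter \<open>u'\<close> would make \<open>xs @ [i]\<close> shorter than
        \<open>xs\<close>, against the premise.\<close>
      then have "act (xs @ [i]) = act (v @ u')" by (auto simp: fun_eq_iff xs)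
      then have "wlen (xs @ [i]) \<le> wlen v + length u'"
        using wlen_append_le[of v u'] wlen_cong[of "xs @ [i]" "v @ u'"] by simp
      then show ?thesis using u' u(3) less.prems by linarith
    qed
  qed
qed

subsection \<open>Orbits of dominant elements\<close>

text \<open>Each letter \<open>j\<close> of a reduced word contributes \<open>f j \<mu>\<close>
  times a root that is positive by Tits' lemma; dominance makes the factor nonnegative.\<close>

lemma dominant_diff_act:
  assumes dom: "\<And>i. 0 \<le> f i \<mu>"
  shows "\<mu> - act xs \<mu> \<in> pos_cone UNIV"
proof (induction "wlen xs" arbitrary: xs rule: less_induct)
  case less
  show ?case
  proof (cases xs rule: reduced_cases)
    case 1
    then show ?thesis by (simp add: pos_cone_zero)
  next
    case (2 zs j)
    have "\<mu> - act xs \<mu> = (\<mu> - act zs \<mu>) + f j \<mu> *\<^sub>R act zs (\<alpha> j)"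
      using 2 by (simp add: s_def linear_diff[OF linear_act] linear_scale[OF linear_act])
    moreover have "act zs (\<alpha> j) \<in> pos_cone UNIV"
      using 2 wlen_cong[of xs "zs @ [j]"] by (intro act_root_nonneg) simp
    then have "(\<mu> - act zs \<mu>) + f j \<mu> *\<^sub>R act zs (\<alpha> j) \<in> pos_cone UNIV"
      using less 2 dom by (intro pos_cone_add pos_cone_scale) auto
    ultimately show ?thesis by metis
  qed
qed

lemma dominant_diff_act_parabolic:
  assumes dom: "\<And>i. 0 \<le> f i \<mu>" and "set xs \<subseteq> J"
  shows "\<mu> - act xs \<mu> \<in> pos_cone J"
proof -
  have "\<mu> - act xs \<mu> \<in> span (\<alpha> ` J)"
    using span_neg[OF span_diff_act[OF assms(2)], of \<mu>] by simp
  then show ?thesis using dominant_diff_act[OF dom] by (simp add: mem_pos_cone)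
qed

text \<open>Take \<open>y\<close> of minimal length in the coset of \<open>(act xs)\<inverse>\<close> modulo the parabolic subgroup of \<open>J\<close>. Then
  \<open>y\<close> maps the cone of \<open>J\<close> into the full cone, which forces \<open>y \<mu> = \<mu>\<close>.\<close>

lemma orbit_in_parabolic_cone:
  assumes dom: "\<And>i. 0 \<le> f i \<mu>" and cone: "\<mu> - act xs \<mu> \<in> pos_cone J"
  shows "\<exists>ys. set ys \<subseteq> J \<and> act xs \<mu> = act ys \<mu>"
proof -
  obtain u where u: "set u \<subseteq> J" and min: "\<And>u'. set u' \<subseteq> J \<Longrightarrow> wlen (rev xs @ u) \<le> wlen (rev xs @ u')"
    using ex_has_least_nat[of "\<lambda>u. set u \<subseteq> J" "[]" "\<lambda>u. wlen (rev xs @ u)"] by auto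
  define y where "y = rev xs @ u"
  have y_root: "act y (\<alpha> j) \<in> pos_cone UNIV" if "j \<in> J" for j
    using min[of "u @ [j]"] u that by (intro act_root_nonneg) (auto simp: y_def)
  define \<nu> where "\<nu> = act (rev u @ xs) \<mu>"
  have act_y_\<nu>: "act y \<nu> = \<mu>" by (simp add: y_def \<nu>_def)
  have "\<mu> - \<nu> = (\<mu> - act xs \<mu>) - (act (rev u) (act xs \<mu>) - act xs \<mu>)"
    by (simp add: \<nu>_def)
  also have "\<dots> \<in> span (\<alpha> ` J)"
    using cone u by (intro span_diff[OF _ span_diff_act]) (auto simp: mem_pos_cone)
  finally have "\<mu> - \<nu> = (\<Sum>j\<in>J. coord j (\<mu> - \<nu>) *\<^sub>R \<alpha> j)"
    by (rule span_eq_coord)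
  then have "act y (\<mu> - \<nu>) = (\<Sum>j\<in>J. coord j (\<mu> - \<nu>) *\<^sub>R act y (\<alpha> j))"
    by (metis (no_types, lifting) linear_sum[OF linear_act] linear_scale[OF linear_act] sum.cong)
  also have "\<dots> \<in> pos_cone UNIV"
    using dominant_diff_act[OF dom, of "rev u @ xs"] y_root
    by (intro pos_cone_sum pos_cone_scale) (auto simp: \<nu>_def mem_pos_cone)
  \<comment> \<open>Dominance puts \<open>\<mu> - act y \<mu>\<close> in the cone, and now its
    negative lies there too; the cone is pointed.\<close>
  finally have "- (\<mu> - act y \<mu>) \<in> pos_cone UNIV"
    by (simp add: linear_diff[OF linear_act] act_y_\<nu>)
  then have "\<mu> - act y \<mu> = 0"
    using dominant_diff_act[OF dom] by (rule pos_cone_antisym[rotated])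
  then have "act (rev y) (act y \<mu>) = act (rev y) (act y \<nu>)" using act_y_\<nu> by simp
  then have "act u \<nu> = act u \<mu>" by simp
  then show ?thesis using u by (intro exI[of _ u]) (simp add: \<nu>_def)
qed

end

section \<open>Supporting hyperplanes of convex hulls\<close>

text \<open>The open half-space together with the hull of the contact points is convex, since a
  proper combination involving a point strictly below the bound stays strictly below. It contains
  \<open>S\<close>, hence the hull of \<open>S\<close>.\<close>

lemma convex_hull_Int_supporting_hyperplane:
  fixes S :: "'a::euclidean_space set"
  assumes le: "\<And>x. x \<in> S \<Longrightarrow> a \<bullet> x \<le> b"
  shows "convex hull S \<inter> {x. a \<bullet> x = b} = convex hull (S \<inter> {x. a \<bullet> x = b})" (is "_ = ?T")
proof
  have T: "a \<bullet> x = b" if "x \<in> ?T" for x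
    using that hull_minimal[of "S \<inter> {x. a \<bullet> x = b}" "{x. a \<bullet> x = b}" convex] convex_hyperplane by blast
  have "convex ({x. a \<bullet> x < b} \<union> ?T)"
  proof (rule iffD2[OF convex_alt], intro ballI allI impI)
    fix x y u assume xy: "x \<in> {x. a \<bullet> x < b} \<union> ?T" "y \<in> {x. a \<bullet> x < b} \<union> ?T" and u: "0 \<le> u \<and> u \<le> (1::real)"
    let ?z = "(1 - u) *\<^sub>R x + u *\<^sub>R y"
    have le: "a \<bullet> x \<le> b" "a \<bullet> y \<le> b" using xy T by force+
    consider "u = 0" | "u = 1" | "0 < u" "u < 1" "a \<bullet> x < b \<or> a \<bullet> y < b" | "x \<in> ?T" "y \<in> ?T"
      using u xy by fastforce
    then show "?z \<in> {x. a \<bullet> x < b} \<union> ?T"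
    proof cases
      case 1
      then show ?thesis using xy(1) by simp
    next
      case 2
      then show ?thesis using xy(2) by simp
    next
      case 3
      have "0 \<le> (1 - u) * (b - a \<bullet> x)" "0 \<le> u * (b - a \<bullet> y)"
        using u le by auto
      moreover have "0 < (1 - u) * (b - a \<bullet> x) \<or> 0 < u * (b - a \<bullet> y)"
        using 3 by auto
      ultimately have "0 < (1 - u) * (b - a \<bullet> x) + u * (b - a \<bullet> y)" by linarith
      then show ?thesis by (simp add: inner_add_right algebra_simps)
    next
      case 4
      then show ?thesis
        using u convexD_alt[OF convex_convex_hull[of "S \<inter> {x. a \<bullet> x = b}"]] by blast
    qed
  qed
  moreover have "S \<subseteq> {x. a \<bullet> x < b} \<union> ?T"
    using le hull_subset[of "S \<inter> {x. a \<bullet> x = b}" convex] by force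
  ultimately have "convex hull S \<subseteq> {x. a \<bullet> x < b} \<union> ?T" by (rule hull_minimal[rotated])
  then show "convex hull S \<inter> {x. a \<bullet> x = b} \<subseteq> ?T" by auto
  show "?T \<subseteq> convex hull S \<inter> {x. a \<bullet> x = b}"
    using T hull_mono[of "S \<inter> {x. a \<bullet> x = b}" S convex] by auto
qed

context root_datum begin

subsection \<open>The orbit hull of a parabolic subgroup\<close>

definition orbit :: "'m set \<Rightarrow> 'v \<Rightarrow> 'v set" where
  "orbit J \<mu> = {act xs \<mu> |xs. set xs \<subseteq> J}"

lemma self_in_orbit: "\<mu> \<in> orbit J \<mu>"
  unfolding orbit_def by (auto intro: exI[of _ "[]"])

lemma s_orbit_hull:
  assumes "x \<in> convex hull orbit J \<mu>" "j \<in> J"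
  shows "s j x \<in> convex hull orbit J \<mu>"
proof -
  have "s j (act xs \<mu>) \<in> orbit J \<mu>" if "set xs \<subseteq> J" for xs
    using assms(2) that unfolding orbit_def by (intro CollectI exI[of _ "j # xs"]) auto
  then have "s j ` orbit J \<mu> \<subseteq> orbit J \<mu>" unfolding orbit_def by blast
  then have "s j ` (convex hull orbit J \<mu>) \<subseteq> convex hull orbit J \<mu>"
    by (simp add: convex_hull_linear_image[OF linear_s] hull_mono)
  then show ?thesis using assms(1) by blast
qed

lemma convex_diff_pos_cone: "convex {x. \<mu> - x \<in> pos_cone J}"
  unfolding convex_alt
proof (intro ballI allI impI CollectI)
  fix x y and u :: real
  assume "x \<in> {x. \<mu> - x \<in> pos_cone J}" "y \<in> {x. \<mu> - x \<in> pos_cone J}" "0 \<le> u \<and> u \<le> 1"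
  then have "(1 - u) *\<^sub>R (\<mu> - x) + u *\<^sub>R (\<mu> - y) \<in> pos_cone J"
    by (intro pos_cone_add pos_cone_scale) auto
  then show "\<mu> - ((1 - u) *\<^sub>R x + u *\<^sub>R y) \<in> pos_cone J"
    by (simp add: algebra_simps)
qed

lemma orbit_hull_subset_cone:
  assumes dom: "\<And>i. 0 \<le> f i \<mu>" and "x \<in> convex hull orbit J \<mu>"
  shows "\<mu> - x \<in> pos_cone J"
proof -
  have "convex hull orbit J \<mu> \<subseteq> {x. \<mu> - x \<in> pos_cone J}"
    using dominant_diff_act_parabolic[OF dom]
    by (intro hull_minimal convex_diff_pos_cone) (auto simp: orbit_def)
  then show ?thesis using assms(2) by auto
qed

lemma pos_cone_restrict:
  assumes "x \<in> pos_cone UNIV" and "\<And>i. i \<notin> J \<Longrightarrow> coord i x = 0"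
  shows "x \<in> pos_cone J"
proof -
  have "x = (\<Sum>i\<in>UNIV. coord i x *\<^sub>R \<alpha> i)"
    using assms(1) by (intro span_eq_coord) (simp add: mem_pos_cone)
  also have "\<dots> = (\<Sum>i\<in>J. coord i x *\<^sub>R \<alpha> i)"
    by (rule sum.mono_neutral_right) (auto simp: assms(2))
  finally show ?thesis using assms(1)
    unfolding pos_cone_def[of J] by (intro CollectI exI[of _ "\<lambda>i. coord i x"]) (auto simp: mem_pos_cone)
qed

text \<open>A sum of nonnegative coordinates vanishes only termwise, so the maximum over the full
  orbit is attained exactly where \<open>\<mu> - x\<close> lies in the cone of \<open>J\<close>;
  \<open>orbit_in_parabolic_cone\<close> returns such points to the small orbit.\<close>

lemma orbit_hull_face:
  assumes dom: "\<And>i. 0 \<le> f i \<mu>"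
  shows "convex hull orbit J \<mu> face_of convex hull orbit UNIV \<mu>"
proof -
  define \<phi> :: "'v \<Rightarrow> real" where "\<phi> x = (\<Sum>i\<in>-J. coord i x)" for x
  have "linear \<phi>"
    by (rule linearI) (simp_all add: \<phi>_def coord_simps(1,3) sum.distrib sum_distrib_left)
  define a where "a = adjoint \<phi> 1"
  have a: "a \<bullet> x = \<phi> x" for x
    using adjoint_works[OF \<open>linear \<phi>\<close>, of x 1] by (simp add: a_def inner_commute)
  have diff: "a \<bullet> x - a \<bullet> \<mu> = - (\<Sum>i\<in>-J. coord i (\<mu> - x))" for x
    by (simp add: a \<phi>_def coord_simps(2) sum_subtractf)
  have le: "a \<bullet> x \<le> a \<bullet> \<mu>" if "x \<in> convex hull orbit UNIV \<mu>" for x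
    using orbit_hull_subset_cone[OF dom that] diff[of x] 
      sum_nonneg[of "- J" "\<lambda>i. coord i (\<mu> - x)"] by (simp add: mem_pos_cone)
  have "orbit UNIV \<mu> \<inter> {x. a \<bullet> x = a \<bullet> \<mu>} = orbit J \<mu>"
  proof safe
    fix x assume x: "x \<in> orbit UNIV \<mu>" "a \<bullet> x = a \<bullet> \<mu>"
    then have cone: "\<mu> - x \<in> pos_cone UNIV"
      using orbit_hull_subset_cone[OF dom hull_inc] by blast
    moreover have "(\<Sum>i\<in>-J. coord i (\<mu> - x)) = 0" using diff[of x] x(2) by simp
    then have "coord i (\<mu> - x) = 0" if "i \<notin> J" for i
      using that cone by (subst (asm) sum_nonneg_eq_0_iff) (auto simp: mem_pos_cone)
    ultimately have "\<mu> - x \<in> pos_cone J" by (rule pos_cone_restrict)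
    then show "x \<in> orbit J \<mu>"
      using x(1) orbit_in_parabolic_cone[OF dom] unfolding orbit_def by fastforce
  next
    fix x assume x: "x \<in> orbit J \<mu>"
    then show "x \<in> orbit UNIV \<mu>" by (auto simp: orbit_def)
    have "\<mu> - x \<in> span (\<alpha> ` J)"
      using orbit_hull_subset_cone[OF dom hull_inc[OF x]] by (simp add: mem_pos_cone)
    then show "a \<bullet> x = a \<bullet> \<mu>" using diff[of x] by (simp add: coord_outside)
  qed
  then have "convex hull orbit J \<mu> = convex hull orbit UNIV \<mu> \<inter> {x. a \<bullet> x = a \<bullet> \<mu>}"
    using convex_hull_Int_supporting_hyperplane[of "orbit UNIV \<mu>" a "a \<bullet> \<mu>"] le[OF hull_inc] by auto
  also have "\<dots> face_of convex hull orbit UNIV \<mu>"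
    by (rule face_of_Int_supporting_hyperplane_le[OF convex_convex_hull le])
  finally show ?thesis .
qed

text \<open>An edge \<open>(i, j)\<close> means that \<open>s j\<close> moves
  \<open>\<alpha> i\<close>, the direction in which both later propagation arguments run.\<close>

definition edges :: "'m set \<Rightarrow> ('m \<times> 'm) set" where
  "edges J = {(i, j). i \<noteq> j \<and> A j i \<noteq> 0} \<inter> J \<times> J"

text \<open>mu-connectedness in terms of paths, ready for induction along the diagram.\<close>

definition linked :: "'v \<Rightarrow> 'm set \<Rightarrow> bool" where
  "linked \<mu> J \<longleftrightarrow> (\<forall>i\<in>J. \<exists>j\<in>J. f j \<mu> \<noteq> 0 \<and> (j, i) \<in> (edges J)\<^sup>*)"

lemma affine_hull_orbit:
  assumes "linked \<mu> J"
  shows "affine hull orbit J \<mu> = {\<mu> + v |v. v \<in> span (\<alpha> ` J)}"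
proof -
  define D where "D = {x - \<mu> |x. x \<in> orbit J \<mu>}"
  have s_D: "s i d \<in> span D" if i: "i \<in> J" and d: "d \<in> D" for i d
  proof -
    obtain xs where xs: "set xs \<subseteq> J" "d = act xs \<mu> - \<mu>"
      using d by (auto simp: D_def orbit_def)
    have mem: "act ys \<mu> - \<mu> \<in> span D" if "set ys \<subseteq> J" for ys
      using that by (intro span_base) (auto simp: D_def orbit_def)
    \<comment> \<open>\<open>D\<close> itself need not be stable, since \<open>s i\<close> may move
      \<open>\<mu>\<close>; the image is a difference of two elements of \<open>D\<close>.\<close>
    have "s i d = (act (i # xs) \<mu> - \<mu>) - (act [i] \<mu> - \<mu>)"
      by (simp add: xs(2) linear_diff[OF linear_s])
    also have "\<dots> \<in> span D" using xs(1) i by (intro span_diff mem) auto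
    finally show ?thesis .
  qed
  have s_span: "s i d \<in> span D" if i: "i \<in> J" and d: "d \<in> span D" for i d
    using d
  proof (induction rule: span_induct_alt)
    case base
    then show ?case by (simp add: linear_0[OF linear_s] span_zero)
  next
    case (step c x y)
    then show ?case using s_D[OF i]
      by (simp add: linear_add[OF linear_s] linear_scale[OF linear_s] span_add span_scale)
  qed
  have divide: "\<alpha> i \<in> span D" if "c *\<^sub>R \<alpha> i \<in> span D" "c \<noteq> 0" for c i
    using span_scale[OF that(1), of "inverse c"] that(2) by simp
  have root: "\<alpha> i \<in> span D" if "i \<in> J" for i
  proof -
    obtain j where j: "j \<in> J" "f j \<mu> \<noteq> 0" "(j, i) \<in> (edges J)\<^sup>*"
      using assms \<open>i \<in> J\<close> by (auto simp: linked_def)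
    have "s j \<mu> - \<mu> \<in> D" using j(1) unfolding D_def orbit_def
      by (intro CollectI exI[of _ "s j \<mu>"] conjI exI[of _ "[j]"]) auto
    then have "(- f j \<mu>) *\<^sub>R \<alpha> j \<in> span D" by (intro span_base) (simp add: s_def)
    then have "\<alpha> j \<in> span D" using j(2) by (intro divide[of "- f j \<mu>"]) auto
    with j(3) show ?thesis
    proof (induction rule: rtrancl_induct)
      case (step k l)
      then have kl: "l \<in> J" "A l k \<noteq> 0" by (auto simp: edges_def)
      \<comment> \<open>Reflecting a root already reached yields a nonzero multiple of the next root
        on the path.\<close>
      have "s l (\<alpha> k) - \<alpha> k \<in> span D" using step kl by (intro span_diff s_span) auto
      then have "(- of_int (A l k)) *\<^sub>R \<alpha> l \<in> span D" by (simp add: s_def f_root)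
      then show ?case using kl(2) by (intro divide[of "- of_int (A l k)"]) auto
    qed
  qed
  have "D \<subseteq> span (\<alpha> ` J)"
    using span_diff_act by (auto simp: D_def orbit_def)
  then have "span D = span (\<alpha> ` J)"
    using root by (intro antisym span_minimal subspace_span) auto
  moreover have "affine hull orbit J \<mu> = {\<mu> + v |v. v \<in> span {x - \<mu> |x. x \<in> orbit J \<mu> - {\<mu>}}}"
    by (rule affine_hull_span[OF self_in_orbit])
  moreover have "span {x - \<mu> |x. x \<in> orbit J \<mu> - {\<mu>}} = span D"
  proof -
    have "{x - \<mu> |x. x \<in> orbit J \<mu> - {\<mu>}} = D - {0}" by (auto simp: D_def)
    then show ?thesis by (simp add: span_delete_0)
  qed
  ultimately show ?thesis by simp
qed

lemma aff_dim_orbit: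
  assumes "linked \<mu> J"
  shows "aff_dim (orbit J \<mu>) = int (card J)"
proof -
  have "aff_dim (orbit J \<mu>) = aff_dim ((+) \<mu> ` span (\<alpha> ` J))"
    by (subst aff_dim_affine_hull[symmetric], subst affine_hull_orbit[OF assms])
      (rule arg_cong[of _ _ aff_dim], auto)
  also have "\<dots> = int (dim (\<alpha> ` J))"
    by (simp add: aff_dim_translation_eq aff_dim_subspace dim_span)
  also have "dim (\<alpha> ` J) = card (\<alpha> ` J)"
    using independent_mono[OF independent_root, of "\<alpha> ` J"] by (intro dim_eq_card_independent) auto
  also have "\<dots> = card J" using inj_root by (simp add: card_image inj_on_subset)
  finally show ?thesis .
qed


subsection \<open>A strictly dominant point in the relative interior\<close>

text \<open>A convex combination of \<open>x\<close> (weight 3/4) and its reflections; a smaller weight of \<open>x\<close> could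
  destroy strict dominance. For \<open>J = {}\<close> the division by zero is harmless, as the sum is empty.\<close>

definition move :: "'m set \<Rightarrow> 'v \<Rightarrow> 'v" where
  "move J x = x - (1 / (4 * real (card J))) *\<^sub>R (\<Sum>j\<in>J. f j x *\<^sub>R \<alpha> j)"

lemma move_orbit_hull:
  assumes "x \<in> convex hull orbit J \<mu>"
  shows "move J x \<in> convex hull orbit J \<mu>"
proof (cases "J = {}")
  case True
  then show ?thesis using assms by (simp add: move_def)
next
  case False
  then have J: "card J \<noteq> 0" by simp
  define y where "y = (\<Sum>j\<in>J. (1 / real (card J)) *\<^sub>R s j x)"
  have "y \<in> convex hull orbit J \<mu>"
    unfolding y_def using assms J by (intro convex_sum s_orbit_hull) auto
  then have "(3 / 4) *\<^sub>R x + (1 / 4) *\<^sub>R y \<in> convex hull orbit J \<mu>"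
    using assms by (intro convexD convex_convex_hull) auto
  moreover have "y = x - (1 / real (card J)) *\<^sub>R (\<Sum>j\<in>J. f j x *\<^sub>R \<alpha> j)"
    using J by (simp add: y_def s_def scaleR_diff_right sum_subtractf scaleR_sum_right sum_constant_scaleR)
  ultimately show ?thesis
    by (simp add: move_def algebra_simps flip: scaleR_add_left)
qed

lemma coord_move:
  "coord i (move J x) = coord i x - (if i \<in> J then f i x / (4 * real (card J)) else 0)"
  by (simp add: move_def coord_simps(2,3) coord_comb)

text \<open>The diagonal entry costs at most half of \<open>f i x\<close> because \<open>J\<close>
  has at least one element; the sum keeps the gain from the neighbours.\<close>

lemma f_move:
  assumes i: "i \<in> J" and dom: "\<And>j. j \<in> J \<Longrightarrow> 0 \<le> f j x"
  shows "f i x / 2 + (\<Sum>j\<in>J - {i}. of_int (- A i j) * f j x) / (4 * real (card J)) \<le> f i (move J x)"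
proof -
  have card: "1 \<le> real (card J)" using i by (simp add: Suc_le_eq card_gt_0_iff) blast
  have "(\<Sum>j\<in>J. f j x * A i j) = 2 * f i x - (\<Sum>j\<in>J - {i}. of_int (- A i j) * f j x)"
    using i by (simp add: sum.remove[of J i] A_diag sum_negf mult.commute)
  then have "f i (move J x) = f i x - (2 * f i x) / (4 * real (card J))
      + (\<Sum>j\<in>J - {i}. of_int (- A i j) * f j x) / (4 * real (card J))"
    by (simp add: move_def f_simps(2,3,6) f_root diff_divide_distrib)
  moreover have "(2 * f i x) / (4 * real (card J)) \<le> f i x / 2"
    using card dom[OF i] mult_left_mono[OF card, of "f i x"] by (simp add: field_simps)
  ultimately show ?thesis by linarith
qed

text \<open>In \<open>f_move\<close> the off-diagonal sum is nonnegative, and strictly positive as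
  soon as one neighbour is.\<close>

lemma f_move_pos:
  assumes i: "i \<in> J" and dom: "\<And>j. j \<in> J \<Longrightarrow> 0 \<le> f j x"
  shows "0 \<le> f i (move J x)"
    and "0 < f i x \<Longrightarrow> 0 < f i (move J x)"
    and "(j, i) \<in> edges J \<Longrightarrow> 0 < f j x \<Longrightarrow> 0 < f i (move J x)"
proof -
  have card: "0 < real (card J)" using i by (simp add: card_gt_0_iff) blast
  have nn: "0 \<le> of_int (- A i j) * f j x" if "j \<in> J - {i}" for j
    using A_off[of i j] dom that by (intro mult_nonneg_nonneg) auto
  then have sum: "0 \<le> (\<Sum>j\<in>J - {i}. of_int (- A i j) * f j x) / (4 * real (card J))"
    by (intro divide_nonneg_nonneg sum_nonneg) auto
  show "0 \<le> f i (move J x)" "0 < f i x \<Longrightarrow> 0 < f i (move J x)"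
    using f_move[OF i dom] sum dom[OF i] by linarith+
  assume e: "(j, i) \<in> edges J" and pos: "0 < f j x"
  then have ij: "j \<in> J - {i}" "A i j < 0" using A_off[of i j] by (auto simp: edges_def)
  then have "0 < of_int (- A i j) * f j x" using pos by (intro mult_pos_pos) auto
  then have "0 < (\<Sum>j\<in>J - {i}. of_int (- A i j) * f j x)"
    using ij(1) nn by (intro sum_pos2) auto
  then have "0 < (\<Sum>j\<in>J - {i}. of_int (- A i j) * f j x) / (4 * real (card J))"
    using card by simp
  then show "0 < f i (move J x)" using f_move[OF i dom] dom[OF i] by linarith
qed

text \<open>Under iteration of \<open>move\<close>, positivity persists once reached and advances
  along one more edge per step, so finitely many steps reach all of \<open>J\<close>.\<close>

lemma strictly_dominant_point:
  assumes dom: "\<And>i. 0 \<le> f i \<mu>" and "linked \<mu> J"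
  shows "\<exists>x\<in>convex hull orbit J \<mu>. \<forall>i\<in>J. 0 < f i x \<and> 0 < coord i (\<mu> - x)"
proof -
  define x where "x n = (move J ^^ n) \<mu>" for n
  have x_Suc: "x (Suc n) = move J (x n)" for n by (simp add: x_def)
  have x_dom: "0 \<le> f i (x n)" if "i \<in> J" for i n
    using that
  proof (induction n arbitrary: i)
    case 0
    then show ?case using dom by (simp add: x_def)
  next
    case (Suc n)
    then show ?case by (simp add: x_Suc f_move_pos(1))
  qed
  have x_hull: "x n \<in> convex hull orbit J \<mu>" for n
    by (induction n) (simp_all add: x_Suc move_orbit_hull, simp add: x_def hull_inc self_in_orbit)
  have mono: "0 < f i (x m)" if "0 < f i (x n)" "n \<le> m" "i \<in> J" for i m n
    using that(2)
  proof (induction m rule: dec_induct)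
    case (step m)
    then show ?case using f_move_pos(2)[OF that(3) x_dom] by (simp add: x_Suc)
  qed (fact that(1))
  have "\<exists>n. 0 < f i (x n)" if "i \<in> J" for i
  proof -
    obtain j where j: "j \<in> J" "f j \<mu> \<noteq> 0" "(j, i) \<in> (edges J)\<^sup>*"
      using assms(2) \<open>i \<in> J\<close> by (auto simp: linked_def)
    from j(3) show ?thesis
    proof (induction rule: rtrancl_induct)
      case base
      then show ?case using j(2) dom[of j] by (intro exI[of _ 0]) (simp add: x_def)
    next
      case (step k l)
      then obtain n where "0 < f k (x n)" by blast
      moreover have "l \<in> J" using step by (auto simp: edges_def)
      ultimately have "0 < f l (x (Suc n))"
        using f_move_pos(3)[OF _ x_dom step(2)] by (simp add: x_Suc)
      then show ?case by blast
    qed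
  qed
  then obtain n where n: "0 < f i (x (n i))" if "i \<in> J" for i by metis
  \<comment> \<open>For empty \<open>J\<close> this maximum is unspecified, but then there is no
    inequality to prove.\<close>
  define N where "N = Max (n ` J)"
  have N: "0 < f i (x N)" if "i \<in> J" for i
    using that by (intro mono[OF n]) (auto simp: N_def)
  have "0 < f i (x (Suc N)) \<and> 0 < coord i (\<mu> - x (Suc N))" if "i \<in> J" for i
  proof
    show "0 < f i (x (Suc N))" using that by (intro mono[OF N]) auto
    \<comment> \<open>The step beyond \<open>N\<close> lowers \<open>coord i\<close> by this
      positive amount, which makes the coordinate inequality strict.\<close>
    have "0 < f i (x N) / (4 * real (card J))"
      using N[OF that] that by (intro divide_pos_pos) (auto simp: card_gt_0_iff)
    moreover have "0 \<le> coord i (\<mu> - x N)"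
      using orbit_hull_subset_cone[OF dom x_hull] by (simp add: mem_pos_cone)
    ultimately show "0 < coord i (\<mu> - x (Suc N))"
      using that by (simp add: x_Suc coord_simps(2) coord_move)
  qed
  then show ?thesis using x_hull by blast
qed

lemma strictly_dominant_rel_interior_point:
  assumes dom: "\<And>i. 0 \<le> f i \<mu>" and "linked \<mu> J"
  shows "\<exists>x\<in>rel_interior (convex hull orbit J \<mu>). \<forall>i\<in>J. 0 < f i x \<and> 0 < coord i (\<mu> - x)"
proof -
  let ?F = "convex hull orbit J \<mu>"
  obtain x where x: "x \<in> ?F" "\<And>i. i \<in> J \<Longrightarrow> 0 < f i x" "\<And>i. i \<in> J \<Longrightarrow> 0 < coord i (\<mu> - x)"
    using strictly_dominant_point[OF assms] by blast
  have "?F \<noteq> {}" using x(1) by blast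
  then obtain y where y: "y \<in> rel_interior ?F"
    using rel_interior_eq_empty[OF convex_convex_hull] by blast
  \<comment> \<open>Each inequality to be preserved is affine in the shift \<open>e\<close> and
    strict at 0, so it holds for small positive \<open>e\<close>.\<close>
  have near: "\<forall>\<^sub>F e in at_right 0. 0 < a - e * b" if "0 < a" for a b :: real
  proof (rule order_tendstoD(1)[OF _ that])
    show "((\<lambda>e. a - e * b) \<longlongrightarrow> a) (at_right 0)"
      by (rule tendsto_eq_intros refl | simp)+
  qed
  have "\<forall>\<^sub>F e in at_right 0. \<forall>i\<in>J. 0 < f i x - e * (f i x - f i y) \<and>
      0 < coord i (\<mu> - x) - e * (coord i (\<mu> - x) - coord i (\<mu> - y))"
    using x by (intro eventually_ball_finite ballI eventually_conj near) auto
  moreover have "\<forall>\<^sub>F e in at_right (0::real). e < 1"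
    using eventually_at_right_real[of 0 1] by (rule eventually_mono) auto
  moreover have "\<forall>\<^sub>F e in at_right (0::real). 0 < e"
    by (rule eventually_at_right_less)
  ultimately have "\<forall>\<^sub>F e in at_right 0. (\<forall>i\<in>J. 0 < f i x - e * (f i x - f i y) \<and>
      0 < coord i (\<mu> - x) - e * (coord i (\<mu> - x) - coord i (\<mu> - y))) \<and> e < 1 \<and> 0 < e"
    by (intro eventually_conj)
  then obtain e where e: "0 < e" "e < 1" and pos: "\<And>i. i \<in> J \<Longrightarrow> 0 < f i x - e * (f i x - f i y)"
      "\<And>i. i \<in> J \<Longrightarrow> 0 < coord i (\<mu> - x) - e * (coord i (\<mu> - x) - coord i (\<mu> - y))"
    using eventually_happens'[OF trivial_limit_at_right_real] by (metis (no_types, lifting))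
  have "x - e *\<^sub>R (x - y) \<in> rel_interior ?F"
    using e by (intro rel_interior_convex_shrink y x(1) convex_convex_hull) auto
  moreover have "f i (x - e *\<^sub>R (x - y)) = f i x - e * (f i x - f i y)" for i
    by (simp add: f_simps(2,3))
  moreover have "coord i (\<mu> - (x - e *\<^sub>R (x - y))) =
      coord i (\<mu> - x) - e * (coord i (\<mu> - x) - coord i (\<mu> - y))" for i
    by (simp add: coord_simps(1-3) algebra_simps)
  ultimately show ?thesis using pos by (metis (no_types, lifting))
qed

section \<open>Commuting reflections and walls outside \<open>J\<close>\<close>

text \<open>Applied to \<open>\<alpha> j\<close>, the two products have coefficients
  \<open>A i j\<close> and \<open>- A i j\<close> at \<open>\<alpha> i\<close>.\<close>

lemma commute_iff:
  assumes "i \<noteq> j"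
  shows "s i \<circ> s j = s j \<circ> s i \<longleftrightarrow> A i j = 0"
proof
  assume "s i \<circ> s j = s j \<circ> s i"
  then have "s i (s j (\<alpha> j)) = s j (s i (\<alpha> j))" by (metis comp_apply)
  then have "coord i (s i (s j (\<alpha> j))) = coord i (s j (s i (\<alpha> j)))" by simp
  then show "A i j = 0"
    using assms by (simp add: s_def f_simps(1-4) f_root A_diag coord_simps(1-4,7))
next
  assume "A i j = 0"
  then show "s i \<circ> s j = s j \<circ> s i"
    using A_zero[of i j] by (auto simp: s_def f_simps(2,3) f_root algebra_simps)
qed

text \<open>For \<open>i\<close> outside \<open>J\<close> the relevant matrix entries are
  nonpositive, so subtracting a positive combination of \<open>J\<close> from \<open>\<mu>\<close>
  only adds nonnegative terms to \<open>f i \<mu>\<close>.\<close>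

lemma f_cone_point:
  assumes cone: "\<mu> - x \<in> pos_cone J" and pos: "\<And>j. j \<in> J \<Longrightarrow> 0 < coord j (\<mu> - x)"
    and "i \<notin> J" "0 \<le> f i \<mu>"
  shows "0 \<le> f i x" and "f i x = 0 \<longleftrightarrow> f i \<mu> = 0 \<and> (\<forall>j\<in>J. A i j = 0)"
proof -
  have nn: "0 \<le> coord j (\<mu> - x) * of_int (- A i j)" if "j \<in> J" for j
    using pos[OF that] A_off[of i j] that \<open>i \<notin> J\<close> by (intro mult_nonneg_nonneg) auto
  have sum_nn: "0 \<le> (\<Sum>j\<in>J. coord j (\<mu> - x) * of_int (- A i j))"
    by (intro sum_nonneg nn)
  have "f i (\<mu> - x) = f i (\<Sum>j\<in>J. coord j (\<mu> - x) *\<^sub>R \<alpha> j)"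
    using cone by (intro arg_cong[of _ _ "f i"] span_eq_coord) (simp add: mem_pos_cone)
  then have eq: "f i x = f i \<mu> + (\<Sum>j\<in>J. coord j (\<mu> - x) * of_int (- A i j))"
    by (simp add: f_simps(2,3,6) f_root sum_negf)
  then show "0 \<le> f i x" using sum_nn assms(4) by linarith
  have "f i x = 0 \<longleftrightarrow> f i \<mu> = 0 \<and> (\<Sum>j\<in>J. coord j (\<mu> - x) * of_int (- A i j)) = 0"
    using eq sum_nn assms(4) by linarith
  also have "\<dots> \<longleftrightarrow> f i \<mu> = 0 \<and> (\<forall>j\<in>J. A i j = 0)"
    using nn pos by (subst sum_nonneg_eq_0_iff) (auto simp: less_le)
  finally show "f i x = 0 \<longleftrightarrow> f i \<mu> = 0 \<and> (\<forall>j\<in>J. A i j = 0)" .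
qed

end

section \<open>Generated subgroups of \<open>GL\<close> as sets of words\<close>

lemma inv_GL_involution:
  assumes "linear g" and "\<And>x. g (g x) = x"
  shows "inv\<^bsub>GL\<^esub> g = g"
  unfolding m_inv_def
proof (rule the_equality)
  have "bij g" using assms(2) by (rule involuntory_imp_bij)
  then show "g \<in> carrier GL \<and> g \<otimes>\<^bsub>GL\<^esub> g = \<one>\<^bsub>GL\<^esub> \<and> g \<otimes>\<^bsub>GL\<^esub> g = \<one>\<^bsub>GL\<^esub>"
    using assms by (auto simp: GL_def)
  show "h = g" if "h \<in> carrier GL \<and> g \<otimes>\<^bsub>GL\<^esub> h = \<one>\<^bsub>GL\<^esub> \<and> h \<otimes>\<^bsub>GL\<^esub> g = \<one>\<^bsub>GL\<^esub>" for h
    using that assms(2) by (auto simp: GL_def fun_eq_iff) metis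
qed

context root_datum begin

text \<open>The generators are their own inverses, so words without inverse letters suffice.\<close>

lemma generate_reflections: "generate GL (s ` J) = act ` {xs. set xs \<subseteq> J}"
proof (intro equalityI subsetI)
  fix w assume "w \<in> generate GL (s ` J)"
  then show "w \<in> act ` {xs. set xs \<subseteq> J}"
  proof (induction rule: generate.induct)
    case one
    show ?case by (intro image_eqI[of _ _ "[]"]) (auto simp: GL_def)
  next
    case (incl h)
    then obtain j where "j \<in> J" "h = s j" by blast
    then show ?case by (intro image_eqI[of _ _ "[j]"]) auto
  next
    case (inv h)
    then obtain j where "j \<in> J" "h = s j" by blast
    then show ?case by (intro image_eqI[of _ _ "[j]"]) (auto simp: inv_GL_involution[OF linear_s])
  next
    case (eng g h)
    then obtain xs ys where "g = act xs" "h = act ys" "set xs \<subseteq> J" "set ys \<subseteq> J" by blast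
    then show ?case by (intro image_eqI[of _ _ "xs @ ys"]) (auto simp: GL_def)
  qed
next
  fix w assume "w \<in> act ` {xs. set xs \<subseteq> J}"
  then obtain xs where "set xs \<subseteq> J" "w = act xs" by blast
  then show "w \<in> generate GL (s ` J)"
  proof (induction xs arbitrary: w)
    case Nil
    then show ?case using generate.one[of GL "s ` J"] by (simp add: GL_def id_def)
  next
    case (Cons j xs)
    have "s j \<otimes>\<^bsub>GL\<^esub> act xs \<in> generate GL (s ` J)"
      using Cons by (intro generate.eng[OF generate.incl]) auto
    moreover have "s j \<otimes>\<^bsub>GL\<^esub> act xs = w" using Cons.prems by (auto simp: GL_def)
    ultimately show ?case by simp
  qed
qed

end

section \<open>Passage to the given realization\<close>

theorem corollary3p7:
  fixes A :: "int ^ 'm ^ 'm"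
    and pair :: "'v::euclidean_space \<Rightarrow> 'h::euclidean_space \<Rightarrow> real"
    and \<alpha> :: "'m \<Rightarrow> 'v" and \<alpha>v :: "'m \<Rightarrow> 'h"
    and \<mu> :: 'v and I :: "'m set" and H F :: "'v set"
  assumes "generalized_cartan_matrix A"
    and "realization A pair \<alpha> \<alpha>v"
    and "\<mu> \<in> fundamental_chamber pair \<alpha>v"
    and "mu_connected pair \<alpha> \<alpha>v \<mu> I"
    and "H = orbit_hull (weyl_group pair \<alpha> \<alpha>v) \<mu>"
    and "F = orbit_hull (weyl_subgroup pair \<alpha> \<alpha>v I) \<mu>"
  shows "fundamental_face pair \<alpha>v F H
    \<and> rel_interior F \<inter> {\<mu> - v |v. v \<in> pos_combinations \<alpha> I}
        \<inter> chamber_facet pair \<alpha>v (lower_star pair \<alpha> \<alpha>v \<mu> I) \<noteq> {}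
    \<and> affine hull F = {\<mu> + v |v. v \<in> span (\<alpha> ` I)}
    \<and> aff_dim F = int (card I)"
proof -
  have bilin: "linear (\<lambda>\<eta>. pair \<eta> h)" for h
    using assms(2) by (simp add: realization_def dual_pairing_def bilinear_def)
  have pair: "pair (\<alpha> j) (\<alpha>v i) = real_of_int (A $ i $ j)" for i j
    using assms(2) by (simp add: realization_def)
  interpret root_datum \<alpha> "\<lambda>i \<eta>. pair \<eta> (\<alpha>v i)" "\<lambda>i j. A $ i $ j"
  proof (rule root_datum.intro)
    show "linear (\<lambda>\<eta>. pair \<eta> (\<alpha>v i))" for i by (rule bilin)
    show "pair (\<alpha> j) (\<alpha>v i) = real_of_int (A $ i $ j)" for i j by (rule pair)
    show "A $ i $ i = 2" "i \<noteq> j \<Longrightarrow> A $ i $ j \<le> 0" "A $ i $ j = 0 \<Longrightarrow> A $ j $ i = 0" for i j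
      using assms(1) unfolding generalized_cartan_matrix_def by blast+
    show "inj \<alpha>" "independent (range \<alpha>)"
      using assms(2) unfolding realization_def by blast+
  qed
  have refl: "reflection pair \<alpha> \<alpha>v = s"
    by (intro ext) (simp add: reflection_def s_def)
  have dom: "0 \<le> pair \<mu> (\<alpha>v i)" for i
    using assms(3) by (simp add: fundamental_chamber_def)
  have hull: "orbit_hull (weyl_subgroup pair \<alpha> \<alpha>v J) \<mu> = convex hull orbit J \<mu>" for J
    unfolding orbit_hull_def weyl_subgroup_def refl generate_reflections orbit_def
    by (rule arg_cong[of _ _ "(hull) convex"]) auto
  have F: "F = convex hull orbit I \<mu>" and H: "H = convex hull orbit UNIV \<mu>"
    using assms(5,6) hull by simp_all
  have edges: "dynkin_edges pair \<alpha> \<alpha>v \<inter> I \<times> I = edges I"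
    by (auto simp: dynkin_edges_def edges_def pair)
  have "linked \<mu> I"
    unfolding linked_def
  proof
    fix i assume i: "i \<in> I"
    \<comment> \<open>This image of \<open>{i}\<close> is the component of \<open>i\<close>;
      symmetry of the edges later reverses the path found in it.\<close>
    then have "\<not> (edges I)\<^sup>* `` {i} \<subseteq> orthogonal_roots pair \<alpha>v \<mu>"
      using assms(4) by (simp add: mu_connected_def dynkin_components_def edges quotientI)
    then obtain j where j: "(i, j) \<in> (edges I)\<^sup>*" "pair \<mu> (\<alpha>v j) \<noteq> 0"
      by (auto simp: orthogonal_roots_def)
    have "j \<in> I" using j(1) i by (induction rule: rtrancl_induct) (auto simp: edges_def)
    moreover have "sym ((edges I)\<^sup>*)"
      using A_zero by (intro sym_rtrancl symI) (auto simp: edges_def)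
    ultimately show "\<exists>j\<in>I. pair \<mu> (\<alpha>v j) \<noteq> 0 \<and> (j, i) \<in> (edges I)\<^sup>*"
      using j by (blast dest: symD)
  qed
  obtain x where x: "x \<in> rel_interior F" "\<And>i. i \<in> I \<Longrightarrow> 0 < pair x (\<alpha>v i)"
      "\<And>i. i \<in> I \<Longrightarrow> 0 < coord i (\<mu> - x)"
    using strictly_dominant_rel_interior_point[OF dom \<open>linked \<mu> I\<close>] F by blast
  have "x \<in> convex hull orbit I \<mu>" using x(1) rel_interior_subset F by blast
  from orbit_hull_subset_cone[OF dom this] have cone: "\<mu> - x \<in> pos_cone I" .
  note outside = f_cone_point[OF cone x(3) _ dom]
  have nonneg: "0 \<le> pair x (\<alpha>v i)" for i
    using x(2)[of i] outside(1)[of i] by fastforce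
  \<comment> \<open>Inside \<open>I\<close> neither side holds; outside, \<open>f_cone_point\<close>
    and \<open>commute_iff\<close> lead to the same vanishing of matrix entries.\<close>
  have zero: "pair x (\<alpha>v i) = 0 \<longleftrightarrow> i \<in> lower_star pair \<alpha> \<alpha>v \<mu> I" for i
  proof (cases "i \<in> I")
    case True
    then show ?thesis using x(2)[of i] by (simp add: lower_star_def)
  next
    case False
    then have "(\<forall>j\<in>I. s i \<circ> s j = s j \<circ> s i) \<longleftrightarrow> (\<forall>j\<in>I. A $ i $ j = 0)"
      by (intro ball_cong refl commute_iff) auto
    then show ?thesis
      using outside(2)[OF _ False] False by (simp add: lower_star_def orthogonal_roots_def refl)
  qed
  have facet: "x \<in> chamber_facet pair \<alpha>v (lower_star pair \<alpha> \<alpha>v \<mu> I)"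
    using zero nonneg by (auto simp: chamber_facet_def less_le)
  have "\<mu> - x \<in> pos_combinations \<alpha> I"
    unfolding pos_combinations_def using x(3) cone
    by (intro CollectI exI[of _ "\<lambda>i. coord i (\<mu> - x)"] conjI span_eq_coord) (auto simp: mem_pos_cone)
  then have "x \<in> {\<mu> - v |v. v \<in> pos_combinations \<alpha> I}"
    by (intro CollectI exI[of _ "\<mu> - x"]) simp
  then have "rel_interior F \<inter> {\<mu> - v |v. v \<in> pos_combinations \<alpha> I}
      \<inter> chamber_facet pair \<alpha>v (lower_star pair \<alpha> \<alpha>v \<mu> I) \<noteq> {}"
    using x(1) facet by blast
  moreover have "fundamental_face pair \<alpha>v F H"
    unfolding fundamental_face_def
    using orbit_hull_face[OF dom, of I] F H x(1) nonneg by (auto simp: fundamental_chamber_def)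
  moreover have "affine hull F = {\<mu> + v |v. v \<in> span (\<alpha> ` I)}" "aff_dim F = int (card I)"
    using affine_hull_orbit[OF \<open>linked \<mu> I\<close>] aff_dim_orbit[OF \<open>linked \<mu> I\<close>]
    by (simp_all add: F affine_hull_convex_hull aff_dim_convex_hull)
  ultimately show ?thesis by blast
qed

end
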